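(* Consider the system of Volterra integral equations $$x_k(t)=\sum_{l=1}^n\int_0^t b_{kl}(t,\tau)x_l(\tau)\,d\tau,\qquad k=1,\dots,n,\ 0\le t<\infty, \qquad (\ast)$$ where the functions $b_{kl}(t,\tau)$, $k,l=1,\dots,n$, are differentiable with respect to the first variable, and the perturbed system $$x_k(t)=\sum_{l=1}^n\int_0^t b_{kl}(t,\tau)x_l(\tau)\,d\tau+f_k(t),\qquad k=1,\dots,n, \qquad (\ast\ast)$$ where $F(t)=(f_1(t),\dots,f_n(t))$ is a continuously differentiable vector function with $f_k(0)=0$, $k=1,\dots,n$. Put $B(t)=\{b_{kl}(t,t)\}_{k,l=1}^n$ and $C(t,\tau)=\{\frac{\partial}{\partial t}b_{kl}(t,\tau)\}_{k,l=1}^n$. Let $\varepsilon>0$ be a sufficiently small positive number. Let $\sup_{t\in[0,\infty)}\|F'(t)\|\le\varepsilon_0\le\varepsilon$. Let for any $t,t'\in[0,\infty)$, $t>t'$, the inequality $$\Lambda(B(t))+\frac{1}{t-t'}\int_{t'}^t\psi^*(\tau)\,d\tau<0$$ be fulfilled, where $$\psi^*(s)=\int_0^s\|C(s,\tau)\|\,d\tau+\frac{\|F'(s)\|}{\varepsilon}.$$ Then the trivial solution of the system $(\ast)$ is stable (with respect to perturbations vanishing at $0$), and $\|X(t)\|\le\varepsilon$ for $t\in[0,\infty)$, where $X(t)=(x_1(t),\dots,x_n(t))$ is the solution of the perturbed system $(\ast\ast)$.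
   Context: Vector functions $X(t)=(x_1(t),\dots,x_n(t))$ are measured by $\|X(t)\|=\max_{1\le k\le n}|x_k(t)|$; for matrices $\|\cdot\|$ is the corresponding operator norm. The logarithmic norm of a matrix $A$ is $\Lambda(A)=\lim_{h\downarrow0}(\|I+hA\|-1)h^{-1}$, with $I$ the identity; for the max-norm, $\Lambda(A)=\max_{1\le i\le n}\bigl(a_{ii}+\sum_{j\ne i}|a_{ij}|\bigr)$. Definition of stability used here: the trivial solution of $(\ast)$ is stable with respect to perturbations $f_k(t)$, $f_k(0)=0$, $k=1,\dots,n$, if for any arbitrarily small $\varepsilon>0$ there exists $\delta(\varepsilon)>0$ such that $\sup_{t\in[0,\infty)}\|F'(t)\|\le\delta(\varepsilon)$ implies $\sup_{t\in[0,\infty)}\|X(t)\|\le\varepsilon$, where $X(t)$ is the solution of the perturbed system $(\ast\ast)$ and $F=(f_1,\dots,f_n)$.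
   Formalization: For the stability claim the inequality is required for every perturbation F with sup‖F'‖ ≤ ε₀, where ε₀ > 0, not only for one given F; with a single F (e.g. F = 0, b = −1/(1+τ)²) stability fails. The bound ‖X‖ ≤ ε is proved for each single F. *)

theory Defs
  imports "HOL-Analysis.Analysis"
begin

(* Vectors in R^n are of type real ^ 'n; the max-norm is infnorm. *)

(* Operator norm induced by infnorm; the library's onorm is the one induced by the Euclidean norm.
   As in onorm, the term for x = 0 is 0 / 0 = 0 and does not affect the supremum. *)
definition inf_opnorm :: "real ^ 'n ^ 'n \<Rightarrow> real" where
  "inf_opnorm A = (SUP x. infnorm (A *v x) / infnorm x)"

definition log_norm :: "real ^ 'n ^ 'n \<Rightarrow> real" where
  "log_norm A = Lim (at_right 0) (\<lambda>h. (inf_opnorm (mat 1 + h *\<^sub>R A) - 1) / h)"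

(* A kernel is a family b k l t \<tau>; only its values for 0 \<le> \<tau> \<le> t are ever used. *)

definition B_mat :: "('n \<Rightarrow> 'n \<Rightarrow> real \<Rightarrow> real \<Rightarrow> real) \<Rightarrow> real \<Rightarrow> real ^ 'n ^ 'n" where
  "B_mat b t = (\<chi> k l. b k l t t)"

(* The derivative is taken within {\<tau>..}, i.e. inside the domain 0 \<le> \<tau> \<le> t: it is the ordinary
   partial derivative for t > \<tau> and the right-hand one on the diagonal t = \<tau>. *)
definition C_mat :: "('n \<Rightarrow> 'n \<Rightarrow> real \<Rightarrow> real \<Rightarrow> real) \<Rightarrow> real \<Rightarrow> real \<Rightarrow> real ^ 'n ^ 'n" where
  "C_mat b t \<tau> = (\<chi> k l. vector_derivative (\<lambda>s. b k l s \<tau>) (at t within {\<tau>..}))"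

(* Differentiability in the first variable, together with the existence, as Lebesgue integrals,
   of the integrals of the kernel that occur in the equations and in psi_star below. *)
definition volterra_kernel :: "('n::finite \<Rightarrow> 'n \<Rightarrow> real \<Rightarrow> real \<Rightarrow> real) \<Rightarrow> bool" where
  "volterra_kernel b \<longleftrightarrow>
     (\<forall>k l \<tau> t. 0 \<le> \<tau> \<longrightarrow> \<tau> \<le> t \<longrightarrow> (\<lambda>s. b k l s \<tau>) differentiable (at t within {\<tau>..})) \<and>
     (\<forall>k l t. 0 \<le> t \<longrightarrow> (\<lambda>\<tau>. b k l t \<tau>) absolutely_integrable_on {0..t}) \<and>
     (\<forall>s\<ge>0. (\<lambda>\<tau>. inf_opnorm (C_mat b s \<tau>)) absolutely_integrable_on {0..s}) \<and>
     (\<forall>T\<ge>0. (\<lambda>s. integral {0..s} (\<lambda>\<tau>. inf_opnorm (C_mat b s \<tau>))) absolutely_integrable_on {0..T})"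

definition deriv_on_halfline :: "(real \<Rightarrow> real ^ 'n) \<Rightarrow> real \<Rightarrow> real ^ 'n" where
  "deriv_on_halfline F t = vector_derivative F (at t within {0..})"

definition perturbation :: "(real \<Rightarrow> real ^ 'n) \<Rightarrow> bool" where
  "perturbation F \<longleftrightarrow>
     F 0 = 0 \<and> (\<forall>t\<ge>0. F differentiable (at t within {0..})) \<and>
     continuous_on {0..} (deriv_on_halfline F)"

definition deriv_bounded_by :: "real \<Rightarrow> (real \<Rightarrow> real ^ 'n) \<Rightarrow> bool" where
  "deriv_bounded_by \<delta> F \<longleftrightarrow> (\<forall>t\<ge>0. infnorm (deriv_on_halfline F t) \<le> \<delta>)"

definition solves_perturbed ::
  "('n::finite \<Rightarrow> 'n \<Rightarrow> real \<Rightarrow> real \<Rightarrow> real) \<Rightarrow> (real \<Rightarrow> real ^ 'n) \<Rightarrow> (real \<Rightarrow> real ^ 'n) \<Rightarrow> bool" where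
  "solves_perturbed b F X \<longleftrightarrow>
     continuous_on {0..} X \<and>
     (\<forall>t\<ge>0. \<forall>k. X t $ k = (\<Sum>l\<in>UNIV. integral {0..t} (\<lambda>\<tau>. b k l t \<tau> * X \<tau> $ l)) + F t $ k)"

definition trivial_solution_stable :: "('n::finite \<Rightarrow> 'n \<Rightarrow> real \<Rightarrow> real \<Rightarrow> real) \<Rightarrow> bool" where
  "trivial_solution_stable b \<longleftrightarrow>
     (\<forall>\<epsilon>>0. \<exists>\<delta>>0. \<forall>F X. perturbation F \<longrightarrow> deriv_bounded_by \<delta> F \<longrightarrow> solves_perturbed b F X \<longrightarrow>
        (\<forall>t\<ge>0. infnorm (X t) \<le> \<epsilon>))"

definition psi_star ::
  "('n::finite \<Rightarrow> 'n \<Rightarrow> real \<Rightarrow> real \<Rightarrow> real) \<Rightarrow> (real \<Rightarrow> real ^ 'n) \<Rightarrow> real \<Rightarrow> real \<Rightarrow> real" where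
  "psi_star b F \<epsilon> s =
     integral {0..s} (\<lambda>\<tau>. inf_opnorm (C_mat b s \<tau>)) + infnorm (deriv_on_halfline F s) / \<epsilon>"

definition log_norm_condition ::
  "('n::finite \<Rightarrow> 'n \<Rightarrow> real \<Rightarrow> real \<Rightarrow> real) \<Rightarrow> (real \<Rightarrow> real ^ 'n) \<Rightarrow> real \<Rightarrow> bool" where
  "log_norm_condition b F \<epsilon> \<longleftrightarrow>
     (\<forall>t' t. 0 \<le> t' \<longrightarrow> t' < t \<longrightarrow>
        log_norm (B_mat b t) + 1 / (t - t') * integral {t'..t} (psi_star b F \<epsilon>) < 0)"

end

theory Submission
  imports Defs
begin

text \<open>
  By Fubini the solution satisfies \<open>X' = B X + \<integral>\<^sub>0\<^sup>s C(s, \<tau>) X(\<tau>) d\<tau> + F'\<close> almost everywhere, and Lebesgue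
  differentiation of the averaged hypothesis gives \<open>\<Lambda>(B) + \<psi>\<^sup>* \<le> 0\<close> almost everywhere. Suppose that the
  maximum \<open>M\<close> of \<open>\<parallel>X\<parallel>\<close> on \<open>[0, T]\<close> exceeds \<open>\<epsilon>\<close> and is attained at \<open>c\<close> by \<open>\<sigma> x\<^sub>k\<close>, with a sign \<open>\<sigma>\<close>. The
  defect \<open>y = M - \<sigma> x\<^sub>k \<ge> 0\<close> satisfies \<open>y' \<ge> b\<^sub>k\<^sub>k y - M (\<Lambda>(B) + \<psi>\<^sup>*) \<ge> b\<^sub>k\<^sub>k y\<close> on \<open>[0, c]\<close> and vanishes at \<open>c\<close>,
  so Gronwall's inequality, run backwards from \<open>c\<close>, yields \<open>y = 0\<close> on \<open>[0, c]\<close>. This contradicts \<open>y(0) = M\<close>.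
  Stability follows by scaling, since the system is linear.
\<close>

section \<open>Row-sum formulas for the max-norm operator norm and the logarithmic norm\<close>

lemma infnorm_le_iff_cart: "infnorm (x :: real ^ 'n) \<le> c \<longleftrightarrow> (\<forall>i. \<bar>x $ i\<bar> \<le> c)"
proof
  show "\<forall>i. \<bar>x $ i\<bar> \<le> c" if "infnorm x \<le> c"
    using that component_le_infnorm_cart order_trans by blast
  show "infnorm x \<le> c" if "\<forall>i. \<bar>x $ i\<bar> \<le> c"
    unfolding infnorm_cart using that by (intro cSup_least) auto
qed

lemma abs_matrix_vector_mult_le:
  "\<bar>(A *v x) $ i\<bar> \<le> (\<Sum>j\<in>UNIV. \<bar>A $ i $ j\<bar>) * infnorm (x :: real ^ 'n)"
  unfolding matrix_vector_mult_def sum_distrib_right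
  by (simp, intro order_trans[OF sum_abs] sum_mono)
     (simp add: abs_mult component_le_infnorm_cart mult_left_mono)

lemma infnorm_matrix_vector_mult_le:
  assumes "\<And>i. (\<Sum>j\<in>UNIV. \<bar>A $ i $ j\<bar>) \<le> c"
  shows "infnorm (A *v x) \<le> c * infnorm (x :: real ^ 'n)"
  unfolding infnorm_le_iff_cart
  by (meson abs_matrix_vector_mult_le assms infnorm_pos_le mult_right_mono order_trans)

text \<open>A real \<open>SUP\<close> bounds its family only when the family is bounded above, so
  every later use of \<open>inf_opnorm\<close> as an upper bound rests on this.\<close>

lemma bdd_above_inf_opnorm:
  "bdd_above (range (\<lambda>x. infnorm (A *v x) / infnorm (x :: real ^ 'n)))"
proof -
  define c where "c = Max (range (\<lambda>i. \<Sum>j\<in>UNIV. \<bar>A $ i $ j\<bar>))"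
  have c: "(\<Sum>j\<in>UNIV. \<bar>A $ i $ j\<bar>) \<le> c" for i
    unfolding c_def by (intro Max_ge) auto
  \<comment> \<open>\<open>undefined\<close> stands for an arbitrary row index; index types are
    inhabited.\<close>
  have "0 \<le> c" using c[of undefined] by (meson abs_ge_zero order_trans sum_nonneg)
  then have "infnorm (A *v x) / infnorm x \<le> c" for x
    using infnorm_matrix_vector_mult_le[OF c, of x] infnorm_pos_le[of x]
    by (cases "infnorm x = 0") (auto simp: divide_le_eq)
  then show ?thesis by (auto intro!: bdd_aboveI)
qed

lemma infnorm_mult_le_inf_opnorm: "infnorm (A *v x) \<le> inf_opnorm A * infnorm (x :: real ^ 'n)"
proof (cases "x = 0")
  case False
  then have "infnorm (A *v x) / infnorm x \<le> inf_opnorm A"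
    unfolding inf_opnorm_def using bdd_above_inf_opnorm by (intro cSUP_upper) auto
  with False show ?thesis by (simp add: divide_le_eq infnorm_pos_lt)
qed (simp add: infnorm_0)

lemma inf_opnorm_le:
  assumes "\<And>i. (\<Sum>j\<in>UNIV. \<bar>A $ i $ j\<bar>) \<le> c"
  shows "inf_opnorm (A :: real ^ 'n ^ 'n) \<le> c"
  unfolding inf_opnorm_def
proof (rule cSUP_least)
  fix x :: "real ^ 'n"
  have "0 \<le> c" using assms[of undefined] by (meson abs_ge_zero order_trans sum_nonneg)
  then show "infnorm (A *v x) / infnorm x \<le> c"
    using infnorm_matrix_vector_mult_le[OF assms, of x] infnorm_pos_le[of x]
    by (cases "infnorm x = 0") (auto simp: divide_le_eq)
qed simp

text \<open>The sign pattern of row \<open>i\<close> is a vector of norm 1 at which component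
  \<open>i\<close> of the image equals the row sum. Zero entries get the sign 1, so that every
  component of the vector has modulus 1.\<close>

lemma row_sum_le_inf_opnorm: "(\<Sum>j\<in>UNIV. \<bar>A $ i $ j\<bar>) \<le> inf_opnorm (A :: real ^ 'n ^ 'n)"
proof -
  define x :: "real ^ 'n" where "x = (\<chi> j. if A $ i $ j < 0 then -1 else 1)"
  have "\<bar>x $ j\<bar> = 1" for j by (simp add: x_def)
  then have x: "infnorm x = 1"
    using component_le_infnorm_cart[of x undefined] infnorm_le_iff_cart[of x 1] by force
  have "(A *v x) $ i = (\<Sum>j\<in>UNIV. \<bar>A $ i $ j\<bar>)"
    unfolding matrix_vector_mult_def by (auto simp: x_def intro!: sum.cong)
  then have "(\<Sum>j\<in>UNIV. \<bar>A $ i $ j\<bar>) \<le> infnorm (A *v x)"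
    by (metis abs_ge_self component_le_infnorm_cart order_trans)
  with infnorm_mult_le_inf_opnorm[of A x] x show ?thesis by simp
qed

lemma abs_entry_le_inf_opnorm: "\<bar>A $ i $ j\<bar> \<le> inf_opnorm (A :: real ^ 'n ^ 'n)"
proof -
  have "\<bar>A $ i $ j\<bar> \<le> (\<Sum>j\<in>UNIV. \<bar>A $ i $ j\<bar>)"
    by (rule member_le_sum) auto
  then show ?thesis using row_sum_le_inf_opnorm order_trans by blast
qed

lemma inf_opnorm_eq_Max: "inf_opnorm (A :: real ^ 'n ^ 'n) = (MAX i. \<Sum>j\<in>UNIV. \<bar>A $ i $ j\<bar>)"
proof (rule antisym)
  show "inf_opnorm A \<le> (MAX i. \<Sum>j\<in>UNIV. \<bar>A $ i $ j\<bar>)"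
    by (rule inf_opnorm_le) (auto intro: Max_ge)
  show "(MAX i. \<Sum>j\<in>UNIV. \<bar>A $ i $ j\<bar>) \<le> inf_opnorm A"
    by (auto simp: row_sum_le_inf_opnorm)
qed

text \<open>For small \<open>h > 0\<close> the diagonal of \<open>I + h A\<close> is nonnegative, so
  its absolute row sums are affine in \<open>h\<close> and the difference quotient is constant. The
  limit is therefore that of an eventually constant function.\<close>

lemma log_norm_eq_Max:
  "log_norm (A :: real ^ 'n ^ 'n) = (MAX i. A $ i $ i + (\<Sum>j\<in>UNIV - {i}. \<bar>A $ i $ j\<bar>))"
proof -
  define r where "r i = A $ i $ i + (\<Sum>j\<in>UNIV - {i}. \<bar>A $ i $ j\<bar>)" for i
  \<comment> \<open>The threshold works because the operator norm dominates every entry; the summand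
    1 keeps the denominator positive when \<open>A = 0\<close>.\<close>
  have pos: "1 + h * A $ i $ i \<ge> 0" if "0 < h" "h < 1 / (1 + inf_opnorm A)" for h i
  proof -
    have "0 \<le> inf_opnorm A" using abs_entry_le_inf_opnorm[of A i i] by linarith
    with that have "h * (1 + inf_opnorm A) < 1" by (simp add: field_simps)
    moreover have "h * \<bar>A $ i $ i\<bar> \<le> h * (1 + inf_opnorm A)"
      using that abs_entry_le_inf_opnorm[of A i i] by (intro mult_left_mono) auto
    ultimately have "h * \<bar>A $ i $ i\<bar> \<le> 1" by linarith
    then have "\<bar>h * A $ i $ i\<bar> \<le> 1" using that by (simp add: abs_mult)
    then show ?thesis by linarith
  qed
  have row: "(\<Sum>j\<in>UNIV. \<bar>(mat 1 + h *\<^sub>R A) $ i $ j\<bar>) = 1 + h * r i"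
    if "0 < h" "h < 1 / (1 + inf_opnorm A)" for h i
  proof -
    have "(\<Sum>j\<in>UNIV. \<bar>(mat 1 + h *\<^sub>R A) $ i $ j\<bar>) =
        \<bar>1 + h * A $ i $ i\<bar> + (\<Sum>j\<in>UNIV - {i}. \<bar>(mat 1 + h *\<^sub>R A) $ i $ j\<bar>)"
      by (subst sum.remove[of _ i]) (auto simp: mat_def)
    also have "(\<Sum>j\<in>UNIV - {i}. \<bar>(mat 1 + h *\<^sub>R A) $ i $ j\<bar>) = h * (\<Sum>j\<in>UNIV - {i}. \<bar>A $ i $ j\<bar>)"
      unfolding sum_distrib_left using that by (intro sum.cong) (auto simp: mat_def abs_mult)
    finally show ?thesis using pos[OF that, of i] by (simp add: r_def algebra_simps)
  qed
  have eq: "(inf_opnorm (mat 1 + h *\<^sub>R A) - 1) / h = Max (range r)"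
    if h: "0 < h" "h < 1 / (1 + inf_opnorm A)" for h
  proof -
    have "inf_opnorm (mat 1 + h *\<^sub>R A) = Max ((\<lambda>y. 1 + h * y) ` range r)"
      by (simp only: inf_opnorm_eq_Max row[OF h] image_image)
    \<comment> \<open>A monotone map commutes with the maximum of a finite set.\<close>
    also have "\<dots> = 1 + h * Max (range r)"
      using h by (intro mono_Max_commute[symmetric]) (auto intro!: monoI mult_left_mono)
    finally show ?thesis using h by simp
  qed
  have "0 \<le> inf_opnorm A" using abs_entry_le_inf_opnorm[of A undefined undefined] by linarith
  then have "\<forall>\<^sub>F h in at_right 0. 0 < h \<and> h < 1 / (1 + inf_opnorm A)"
    by (simp add: eventually_at_right_less eventually_conj_iff eventually_at_right[of 0 1])
       (intro exI[of _ "1 / (1 + inf_opnorm A)"], simp)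
  then have "\<forall>\<^sub>F h in at_right 0. (inf_opnorm (mat 1 + h *\<^sub>R A) - 1) / h = Max (range r)"
    by eventually_elim (rule eq, auto)
  then have "((\<lambda>h. (inf_opnorm (mat 1 + h *\<^sub>R A) - 1) / h) \<longlongrightarrow> Max (range r)) (at_right 0)"
    by (rule tendsto_eventually)
  then show ?thesis
    unfolding log_norm_def r_def by (intro tendsto_Lim) auto
qed

lemma row_le_log_norm:
  "A $ i $ i + (\<Sum>j\<in>UNIV - {i}. \<bar>A $ i $ j\<bar>) \<le> log_norm (A :: real ^ 'n ^ 'n)"
  unfolding log_norm_eq_Max by (intro Max_ge) auto

section \<open>Lebesgue differentiation with a fixed right endpoint\<close>

lemma lebesgue_differentiation_left:
  fixes f :: "real \<Rightarrow> real"
  assumes "\<And>a b. f integrable_on {a..b}"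
  shows "\<exists>N. negligible N \<and>
    (\<forall>x. x \<notin> N \<longrightarrow> ((\<lambda>s. integral {s..x} f / (x - s)) \<longlongrightarrow> f x) (at_left x))"
proof -
  \<comment> \<open>The known differentiation theorem averages over intervals to the right of a
    point; applied to the reflected function it yields averages to the left, with the exceptional
    set reflected as well.\<close>
  have r: "(\<lambda>x. f (- x)) integrable_on cbox a b" for a b
    using assms[of "-b" "-a"] Henstock_Kurzweil_Integration.integrable_reflect_real[of f "-a" "-b"]
    by simp
  obtain N where N: "negligible N"
    "\<And>x e. \<lbrakk>x \<notin> N; 0 < e\<rbrakk> \<Longrightarrow> \<exists>d>0. \<forall>h. 0 < h \<and> h < d \<longrightarrow>
        norm (integral (cbox x (x + h *\<^sub>R One)) (\<lambda>x. f (- x)) /\<^sub>R h ^ DIM(real) - f (- x)) < e"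
    using integrable_ccontinuous_explicit[OF r] by metis
  have "((\<lambda>s. integral {s..x} f / (x - s)) \<longlongrightarrow> f x) (at_left x)" if "x \<notin> uminus ` N" for x
  proof (rule tendstoI)
    fix e :: real assume "0 < e"
    have "-x \<notin> N" using that by force
    then obtain d where d: "d > 0" "\<And>h. 0 < h \<Longrightarrow> h < d \<Longrightarrow>
        norm (integral (cbox (-x) (-x + h *\<^sub>R One)) (\<lambda>x. f (- x)) /\<^sub>R h ^ DIM(real) - f (- (-x))) < e"
      using N(2)[OF _ \<open>0 < e\<close>] by blast
    have "dist (integral {s..x} f / (x - s)) (f x) < e" if "x - d < s" "s < x" for s
      using d(2)[of "x - s"] that Henstock_Kurzweil_Integration.integral_reflect_real[of x s f]
      by (simp add: dist_real_def field_simps)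
    then show "\<forall>\<^sub>F s in at_left x. dist (integral {s..x} f / (x - s)) (f x) < e"
      unfolding eventually_at_left[of "x - 1" x, simplified]
      using d(1) by (intro exI[of _ "x - d"]) auto
  qed
  moreover have "negligible (uminus ` N)"
    by (rule negligible_differentiable_image_negligible[OF _ N(1)])
       (auto intro!: derivative_intros simp: differentiable_on_def)
  ultimately show ?thesis by blast
qed


section \<open>Joint measurability of the kernel and Fubini on the triangle\<close>

text \<open>Fubini is used for the product of the completed measure with itself, because absolute
  integrability makes the sections of the kernel only Lebesgue measurable.\<close>

lemma sigma_finite_lebesgue: "sigma_finite_measure (lebesgue :: real measure)"
proof
  show "\<exists>A. countable A \<and> A \<subseteq> sets (lebesgue :: real measure) \<and> \<Union>A = space lebesgue
      \<and> (\<forall>a\<in>A. emeasure lebesgue a \<noteq> \<infinity>)"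
  proof (intro exI[of _ "range (\<lambda>n. {- real n..real n})"] conjI)
    have "\<exists>n. x \<in> {- real n..real n}" for x :: real
      using real_arch_simple[of "\<bar>x\<bar>"] by (simp add: abs_le_iff) (metis minus_le_iff)
    then show "(\<Union>n. {- real n..real n}) = space lebesgue" by auto
  qed auto
qed

interpretation lebesgue2: pair_sigma_finite "lebesgue :: real measure" "lebesgue :: real measure"
  by (intro pair_sigma_finite.intro sigma_finite_lebesgue)

text \<open>The kernel is measurable in \<open>\<tau>\<close> and right-continuous in \<open>t\<close>, so it is the pointwise limit of
  its values at the grid points \<open>\<lfloor>(n + 1) t + 1\<rfloor> / (n + 1)\<close>. These lie strictly to the right of \<open>t\<close>,
  which keeps \<open>\<tau> \<le> t\<close> inside the domain.\<close>

lemma measurable_kernel: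
  fixes f :: "real \<Rightarrow> real \<Rightarrow> real"
  assumes cont: "\<And>\<tau> t. 0 \<le> \<tau> \<Longrightarrow> \<tau> \<le> t \<Longrightarrow> continuous (at t within {\<tau>..}) (\<lambda>s. f s \<tau>)"
    and meas: "\<And>t. 0 \<le> t \<Longrightarrow> (\<lambda>\<tau>. indicator {0..t} \<tau> * f t \<tau>) \<in> borel_measurable lebesgue"
    and "0 \<le> a"
  shows "(\<lambda>(t, \<tau>). if 0 \<le> \<tau> \<and> \<tau> \<le> t then f (t + a) \<tau> else 0)
           \<in> borel_measurable (lebesgue \<Otimes>\<^sub>M lebesgue)"
proof -
  have [measurable]: "(\<lambda>x. x) \<in> lebesgue \<rightarrow>\<^sub>M (borel :: real measure)"
    by (simp add: measurable_completion)
  define p where "p n t = (of_int \<lfloor>real (Suc n) * t + 1\<rfloor> :: real) / real (Suc n)" for n t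
  have p_gt: "t < p n t" for n t
    unfolding p_def by (simp add: pos_less_divide_eq mult.commute)
  have p_le: "p n t \<le> t + 1 / real (Suc n)" for n t
  proof -
    have "p n t \<le> (real (Suc n) * t + 1) / real (Suc n)"
      unfolding p_def by (intro divide_right_mono) linarith+
    also have "\<dots> = t + 1 / real (Suc n)" by (simp add: add_divide_distrib del: of_nat_Suc)
    finally show ?thesis .
  qed
  have p_lim: "(\<lambda>n. p n t) \<longlonglongrightarrow> t" for t
  proof (rule tendsto_sandwich[of "\<lambda>_. t" _ _ "\<lambda>n. t + 1 / real (Suc n)"])
    show "(\<lambda>n. t + 1 / real (Suc n)) \<longlonglongrightarrow> t"
      using LIMSEQ_inverse_real_of_nat_add[of t] by (simp add: inverse_eq_divide)
  qed (use p_le p_gt in \<open>auto intro!: always_eventually less_imp_le simp del: of_nat_Suc\<close>)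
  \<comment> \<open>Passing to \<open>max 0 t\<close> removes the side condition
    \<open>0 \<le> t\<close>, so the fact covers every grid value, including negative ones.\<close>
  have [measurable]: "(\<lambda>\<tau>. indicator {0..max 0 t} \<tau> * f (max 0 t) \<tau>) \<in> borel_measurable lebesgue" for t
    using meas[of "max 0 t"] by simp
  define g where "g n z =
      indicator {z. 0 \<le> snd z \<and> snd z \<le> fst z} z *
      (indicator {0..max 0 (p n (fst z + a))} (snd z) * f (max 0 (p n (fst z + a))) (snd z))"
    for n and z :: "real \<times> real"
  have "g n \<in> borel_measurable (lebesgue \<Otimes>\<^sub>M lebesgue)" for n
  proof -
    \<comment> \<open>Only countably many sections occur here: an integer that depends measurably on
      \<open>z\<close> selects the section, which gives joint measurability.\<close>
    have "(\<lambda>z. (\<lambda>i z. indicator {0..max 0 (of_int i / real (Suc n))} (snd z)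
              * f (max 0 (of_int i / real (Suc n))) (snd z)) \<lfloor>real (Suc n) * (fst z + a) + 1\<rfloor> z)
        \<in> borel_measurable (lebesgue \<Otimes>\<^sub>M lebesgue)"
      by (rule measurable_compose_countable) measurable
    then show ?thesis
      unfolding g_def p_def by measurable
  qed
  moreover have "(\<lambda>n. g n z) \<longlonglongrightarrow> (case z of (t, \<tau>) \<Rightarrow> if 0 \<le> \<tau> \<and> \<tau> \<le> t then f (t + a) \<tau> else 0)" for z
  proof (cases "0 \<le> snd z \<and> snd z \<le> fst z")
    case True
    have "filterlim (\<lambda>n. p n (fst z + a)) (at (fst z + a) within {snd z..}) sequentially"
      unfolding filterlim_at using p_lim p_gt[of "fst z + a"] True \<open>0 \<le> a\<close>
      by (auto intro!: eventuallyI simp: less_imp_neq[symmetric] dest: less_imp_le)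
         (smt (verit, best) p_gt)+
    then have "(\<lambda>n. f (p n (fst z + a)) (snd z)) \<longlonglongrightarrow> f (fst z + a) (snd z)"
      using cont[of "snd z" "fst z + a"] True \<open>0 \<le> a\<close>
      unfolding continuous_within by (auto intro: filterlim_compose)
    moreover have "g n z = f (p n (fst z + a)) (snd z)" for n
      using True \<open>0 \<le> a\<close> p_gt[of "fst z + a" n] by (auto simp: g_def max_def)
    ultimately show ?thesis using True by (simp add: case_prod_beta)
  qed (auto simp: g_def case_prod_beta)
  ultimately show ?thesis
    by (rule borel_measurable_LIMSEQ_real[rotated])
qed


text \<open>For fixed \<open>\<tau>\<close> the fundamental theorem gives that
  \<open>f T \<tau> - f \<tau> \<tau>\<close> is the integral of \<open>g s \<tau>\<close> over
  \<open>s\<close> in \<open>{\<tau>..T}\<close>. Integrating over \<open>\<tau>\<close> and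
  exchanging the order on the triangle yields the formula; the majorant \<open>h\<close> provides
  the integrability for Fubini. The diagonal is integrable as the difference of \<open>f T\<close>
  and the function so obtained.\<close>

lemma kernel_integral_exchange:
  fixes f g h :: "real \<Rightarrow> real \<Rightarrow> real"
  assumes der: "\<And>\<tau> t. 0 \<le> \<tau> \<Longrightarrow> \<tau> \<le> t \<Longrightarrow>
      ((\<lambda>s. f s \<tau>) has_vector_derivative g t \<tau>) (at t within {\<tau>..})"
    and int: "\<And>t. 0 \<le> t \<Longrightarrow> f t absolutely_integrable_on {0..t}"
    and h: "\<And>s. 0 \<le> s \<Longrightarrow> h s absolutely_integrable_on {0..s}"
    and le: "\<And>s \<tau>. 0 \<le> \<tau> \<Longrightarrow> \<tau> \<le> s \<Longrightarrow> \<bar>g s \<tau>\<bar> \<le> h s \<tau>"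
    and h2: "(\<lambda>s. integral {0..s} (h s)) absolutely_integrable_on {0..T}"
    and T: "0 \<le> T"
  shows "(\<lambda>\<tau>. f \<tau> \<tau>) absolutely_integrable_on {0..T}"
    and "(\<lambda>s. integral {0..s} (g s)) absolutely_integrable_on {0..T}"
    and "integral {0..T} (f T) =
           integral {0..T} (\<lambda>\<tau>. f \<tau> \<tau>) + integral {0..T} (\<lambda>s. integral {0..s} (g s))"
    and "\<And>s. 0 \<le> s \<Longrightarrow> g s absolutely_integrable_on {0..s}"
proof -
  have cont: "continuous (at t within {\<tau>..}) (\<lambda>s. f s \<tau>)" if "0 \<le> \<tau>" "\<tau> \<le> t" for t \<tau>
    using der[OF that] has_vector_derivative_continuous by blast
  have meas: "(\<lambda>\<tau>. indicator {0..t} \<tau> * f t \<tau>) \<in> borel_measurable lebesgue" if "0 \<le> t" for t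
    using int[OF that] unfolding set_integrable_def by (auto dest: borel_measurable_integrable)
  define F where "F a = (\<lambda>(t, \<tau>). if 0 \<le> \<tau> \<and> \<tau> \<le> t then f (t + a) \<tau> else 0)" for a
  have F [measurable]: "F a \<in> borel_measurable (lebesgue \<Otimes>\<^sub>M lebesgue)" if "0 \<le> a" for a
    unfolding F_def using cont meas that by (rule measurable_kernel)
  define G0 where "G0 = (\<lambda>(t, \<tau>). if 0 \<le> \<tau> \<and> \<tau> \<le> t then g t \<tau> else 0)"
  have [measurable]: "G0 \<in> borel_measurable (lebesgue \<Otimes>\<^sub>M lebesgue)"
  proof (rule borel_measurable_LIMSEQ_real)
    \<comment> \<open>Forward difference quotients: the shift \<open>a\<close> in
      \<open>measurable_kernel\<close> is there for them. Steps to the right stay in the domain and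
      reach the one-sided derivative on the diagonal.\<close>
    show "(\<lambda>z. real (Suc n) * (F (1 / real (Suc n)) z - F 0 z)) \<in> borel_measurable (lebesgue \<Otimes>\<^sub>M lebesgue)" for n
      by (intro borel_measurable_times borel_measurable_diff borel_measurable_const F) auto
    show "(\<lambda>n. real (Suc n) * (F (1 / real (Suc n)) z - F 0 z)) \<longlonglongrightarrow> G0 z" for z
    proof (cases "0 \<le> snd z \<and> snd z \<le> fst z")
      case True
      have "((\<lambda>y. (f y (snd z) - f (fst z) (snd z)) / (y - fst z)) \<longlongrightarrow> g (fst z) (snd z))
          (at (fst z) within {snd z..})"
        using der[of "snd z" "fst z"] True
        by (simp add: has_real_derivative_iff_has_vector_derivative[symmetric] has_field_derivative_iff)
      moreover have "filterlim (\<lambda>n. fst z + 1 / real (Suc n)) (at (fst z) within {snd z..}) sequentially"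
        unfolding filterlim_at using True LIMSEQ_inverse_real_of_nat_add[of "fst z"]
        by (auto intro!: always_eventually simp: inverse_eq_divide add_increasing2)
      ultimately have "(\<lambda>n. (f (fst z + 1 / real (Suc n)) (snd z) - f (fst z) (snd z))
          / (fst z + 1 / real (Suc n) - fst z)) \<longlonglongrightarrow> g (fst z) (snd z)"
        by (rule filterlim_compose)
      then show ?thesis using True by (simp add: F_def G0_def case_prod_beta mult.commute)
    qed (auto simp: F_def G0_def case_prod_beta)
  qed
  define G where "G = (\<lambda>z. indicator {0..T} (fst z) * G0 z)"
  have [measurable]: "(\<lambda>x. indicator {0..T} x :: real) \<in> borel_measurable lebesgue"
    by (intro borel_measurable_indicator) simp
  have G [measurable]: "G \<in> borel_measurable (lebesgue \<Otimes>\<^sub>M lebesgue)"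
    unfolding G_def by measurable
  have G0s: "(\<lambda>\<tau>. G0 (s, \<tau>)) = (\<lambda>\<tau>. indicator {0..s} \<tau> *\<^sub>R g s \<tau>)" for s
    by (auto simp: G0_def)
  show g: "g s absolutely_integrable_on {0..s}" if "0 \<le> s" for s
    unfolding set_integrable_def
  proof (rule Bochner_Integration.integrable_bound)
    show "integrable lebesgue (\<lambda>\<tau>. indicator {0..s} \<tau> *\<^sub>R h s \<tau>)"
      using h[OF that] by (simp add: set_integrable_def)
    have "(\<lambda>\<tau>. G0 (s, \<tau>)) \<in> borel_measurable lebesgue" by measurable
    then show "(\<lambda>\<tau>. indicator {0..s} \<tau> *\<^sub>R g s \<tau>) \<in> borel_measurable lebesgue"
      by (simp add: G0s)
    show "AE x in lebesgue. norm (indicator {0..s} x *\<^sub>R g s x) \<le> norm (indicator {0..s} x *\<^sub>R h s x)"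
      using le[of _ s] by (auto simp: indicator_def intro!: AE_I2 order_trans[OF _ abs_ge_self])
  qed
  have Gs: "(\<lambda>\<tau>. G (s, \<tau>)) = (\<lambda>\<tau>. indicator {0..T} s * (indicator {0..s} \<tau> *\<^sub>R g s \<tau>))" for s
    unfolding G_def using fun_cong[OF G0s[of s]] by simp
  have Gi: "integrable lebesgue (\<lambda>\<tau>. G (s, \<tau>))" for s
    using g[of s] unfolding Gs set_integrable_def by (cases "s \<in> {0..T}") auto
  have intG: "integrable (lebesgue \<Otimes>\<^sub>M lebesgue) G"
  proof (rule lebesgue2.Fubini_integrable)
    show "integrable lebesgue (\<lambda>s. \<integral>\<tau>. norm (G (s, \<tau>)) \<partial>lebesgue)"
    proof (rule Bochner_Integration.integrable_bound)
      show "integrable lebesgue (\<lambda>s. indicator {0..T} s *\<^sub>R integral {0..s} (h s))"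
        using h2 by (simp add: set_integrable_def)
      show "(\<lambda>s. \<integral>\<tau>. norm (G (s, \<tau>)) \<partial>lebesgue) \<in> borel_measurable lebesgue"
        by (rule sigma_finite_measure.borel_measurable_lebesgue_integral[OF sigma_finite_lebesgue])
             (simp add: case_prod_beta)
      have "norm (\<integral>\<tau>. norm (G (s, \<tau>)) \<partial>lebesgue) \<le> norm (indicator {0..T} s *\<^sub>R integral {0..s} (h s))" for s
      proof (cases "s \<in> {0..T}")
        case True
        have "(\<integral>\<tau>. norm (G (s, \<tau>)) \<partial>lebesgue) \<le> (\<integral>\<tau>. indicator {0..s} \<tau> *\<^sub>R h s \<tau> \<partial>lebesgue)"
          using h[of s] True le[of _ s] Gi[of s]
          by (intro integral_mono) (auto simp: set_integrable_def G_def G0_def)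
        also have "\<dots> = integral {0..s} (h s)"
          using set_lebesgue_integral_eq_integral(2)[OF h[of s]] True
          by (simp add: set_lebesgue_integral_def)
        finally show ?thesis using True by (auto intro: order_trans[OF _ abs_ge_self])
      next
        case False
        then have "G (s, \<tau>) = 0" for \<tau> by (simp add: G_def)
        then show ?thesis by simp
      qed
      then show "AE s in lebesgue. norm (\<integral>\<tau>. norm (G (s, \<tau>)) \<partial>lebesgue)
          \<le> norm (indicator {0..T} s *\<^sub>R integral {0..s} (h s))" by simp
    qed
  qed (use Gi in auto)
  have inner1: "(\<integral>\<tau>. G (s, \<tau>) \<partial>lebesgue) = indicator {0..T} s *\<^sub>R integral {0..s} (g s)" for s
  proof (cases "s \<in> {0..T}")
    case True
    then show ?thesis
      using set_lebesgue_integral_eq_integral(2)[OF g[of s]]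
      by (simp add: Gs set_lebesgue_integral_def)
  qed (simp add: Gs)
  show g2: "(\<lambda>s. integral {0..s} (g s)) absolutely_integrable_on {0..T}"
    using lebesgue2.integrable_fst'[OF intG] unfolding set_integrable_def inner1 .
  have "AE \<tau> in lebesgue. integrable lebesgue (\<lambda>s. G (s, \<tau>))"
    using lebesgue2.AE_integrable_snd[of "\<lambda>x y. G (x, y)"] intG by simp
  then have inner2: "AE \<tau> in lebesgue. (\<integral>s. G (s, \<tau>) \<partial>lebesgue) = indicator {0..T} \<tau> *\<^sub>R (f T \<tau> - f \<tau> \<tau>)"
  proof eventually_elim
    case (elim \<tau>)
    show ?case
    proof (cases "\<tau> \<in> {0..T}")
      case True
      have eq: "(\<lambda>s. G (s, \<tau>)) = (\<lambda>s. indicator {\<tau>..T} s *\<^sub>R g s \<tau>)"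
        using True by (auto simp: G_def G0_def indicator_def)
      then have "(\<lambda>s. g s \<tau>) absolutely_integrable_on {\<tau>..T}"
        using elim by (simp add: set_integrable_def)
      \<comment> \<open>Fubini makes this section Lebesgue integrable for almost every
        \<open>\<tau>\<close>, so its integral is also the gauge integral, which the fundamental
        theorem evaluates for any derivative.\<close>
      then have "(\<integral>s. G (s, \<tau>) \<partial>lebesgue) = integral {\<tau>..T} (\<lambda>s. g s \<tau>)"
        by (subst set_lebesgue_integral_eq_integral(2)[symmetric])
           (simp_all add: eq set_lebesgue_integral_def)
      moreover have "((\<lambda>s. g s \<tau>) has_integral (f T \<tau> - f \<tau> \<tau>)) {\<tau>..T}"
        using True by (intro fundamental_theorem_of_calculus)
          (auto intro: has_vector_derivative_within_subset[OF der])
      ultimately show ?thesis using True by (simp add: integral_unique)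
    next
      case False
      then have "G (s, \<tau>) = 0" for s by (auto simp: G_def G0_def indicator_def)
      with False show ?thesis by simp
    qed
  qed
  \<comment> \<open>Measurability of the diagonal values comes from joint measurability, by
    composing with the diagonal embedding.\<close>
  have "(\<lambda>\<tau>. (\<tau>, \<tau>)) \<in> lebesgue \<rightarrow>\<^sub>M (lebesgue \<Otimes>\<^sub>M lebesgue :: (real \<times> real) measure)"
    by measurable
  then have "(\<lambda>\<tau>. F 0 (\<tau>, \<tau>)) \<in> borel_measurable lebesgue"
    using F[of 0] by (rule measurable_compose) simp
  then have "(\<lambda>\<tau>. indicator {0..T} \<tau> * F 0 (\<tau>, \<tau>)) \<in> borel_measurable lebesgue"
    by measurable
  also have "(\<lambda>\<tau>. indicator {0..T} \<tau> * F 0 (\<tau>, \<tau>)) = (\<lambda>\<tau>. indicator {0..T} \<tau> *\<^sub>R f \<tau> \<tau>)"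
    by (auto simp: F_def indicator_def)
  finally have diag [measurable]: "(\<lambda>\<tau>. indicator {0..T} \<tau> *\<^sub>R f \<tau> \<tau>) \<in> borel_measurable lebesgue" .
  have fT: "integrable lebesgue (\<lambda>\<tau>. indicator {0..T} \<tau> *\<^sub>R f T \<tau>)"
    using int[OF T] by (simp add: set_integrable_def)
  note [measurable] = borel_measurable_integrable[OF fT]
  have m: "(\<lambda>\<tau>. indicator {0..T} \<tau> *\<^sub>R (f T \<tau> - f \<tau> \<tau>)) \<in> borel_measurable lebesgue"
    unfolding scaleR_diff_right by measurable
  have snd: "integrable lebesgue (\<lambda>\<tau>. \<integral>s. G (s, \<tau>) \<partial>lebesgue)"
    using lebesgue2.integrable_snd[of "\<lambda>x y. G (x, y)"] intG by simp
  have d: "integrable lebesgue (\<lambda>\<tau>. indicator {0..T} \<tau> *\<^sub>R (f T \<tau> - f \<tau> \<tau>))"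
    using inner2 by (intro integrable_cong_AE_imp[OF snd m]) (auto elim: eventually_mono)
  have "integrable lebesgue (\<lambda>\<tau>. indicator {0..T} \<tau> *\<^sub>R f T \<tau> - indicator {0..T} \<tau> *\<^sub>R (f T \<tau> - f \<tau> \<tau>))"
    using fT d by (rule Bochner_Integration.integrable_diff)
  then show diag: "(\<lambda>\<tau>. f \<tau> \<tau>) absolutely_integrable_on {0..T}"
    by (simp add: set_integrable_def algebra_simps)
  have "integral {0..T} (\<lambda>s. integral {0..s} (g s)) = (\<integral>s. \<integral>\<tau>. G (s, \<tau>) \<partial>lebesgue \<partial>lebesgue)"
    unfolding inner1 using set_lebesgue_integral_eq_integral(2)[OF g2]
    by (simp add: set_lebesgue_integral_def)
  also have "\<dots> = (\<integral>\<tau>. \<integral>s. G (s, \<tau>) \<partial>lebesgue \<partial>lebesgue)"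
    using lebesgue2.Fubini_integral[of "\<lambda>x y. G (x, y)"] intG by simp
  also have "\<dots> = (\<integral>\<tau>. indicator {0..T} \<tau> *\<^sub>R (f T \<tau> - f \<tau> \<tau>) \<partial>lebesgue)"
    using snd m inner2 by (intro integral_cong_AE) auto
  also have "\<dots> = integral {0..T} (\<lambda>\<tau>. f T \<tau> - f \<tau> \<tau>)"
    using d by (subst set_lebesgue_integral_eq_integral(2)[symmetric])
      (simp_all add: set_integrable_def set_lebesgue_integral_def)
  also have "\<dots> = integral {0..T} (f T) - integral {0..T} (\<lambda>\<tau>. f \<tau> \<tau>)"
    using int[OF T] diag
    by (intro Henstock_Kurzweil_Integration.integral_diff) (auto dest: set_lebesgue_integral_eq_integral(1))
  finally show "integral {0..T} (f T) =
      integral {0..T} (\<lambda>\<tau>. f \<tau> \<tau>) + integral {0..T} (\<lambda>s. integral {0..s} (g s))" by simp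
qed


lemma absolutely_integrable_mult_continuous:
  fixes f x :: "real \<Rightarrow> real"
  assumes "f absolutely_integrable_on {a..b}" "continuous_on {a..b} x"
  shows "(\<lambda>t. f t * x t) absolutely_integrable_on {a..b}"
proof -
  have "(\<lambda>t. x t * f t) absolutely_integrable_on {a..b}"
    using assms
    by (intro absolutely_integrable_bounded_measurable_product_real
        continuous_imp_measurable_on_sets_lebesgue compact_imp_bounded compact_continuous_image) auto
  then show ?thesis by (simp add: mult.commute)
qed

text \<open>The factor \<open>x \<tau>\<close> does not depend on the variable of differentiation,
  so the weighted kernel satisfies the hypotheses of the exchange, with the majorant multiplied by a
  bound of the factor.\<close>

lemma kernel_integral_exchange_mult:
  fixes f g h :: "real \<Rightarrow> real \<Rightarrow> real"
  assumes der: "\<And>\<tau> t. 0 \<le> \<tau> \<Longrightarrow> \<tau> \<le> t \<Longrightarrow>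
      ((\<lambda>s. f s \<tau>) has_vector_derivative g t \<tau>) (at t within {\<tau>..})"
    and int: "\<And>t. 0 \<le> t \<Longrightarrow> f t absolutely_integrable_on {0..t}"
    and h: "\<And>s. 0 \<le> s \<Longrightarrow> h s absolutely_integrable_on {0..s}"
    and le: "\<And>s \<tau>. 0 \<le> \<tau> \<Longrightarrow> \<tau> \<le> s \<Longrightarrow> \<bar>g s \<tau>\<bar> \<le> h s \<tau>"
    and h2: "(\<lambda>s. integral {0..s} (h s)) absolutely_integrable_on {0..T}"
    and T: "0 \<le> T" and x: "continuous_on {0..T} x"
  shows "(\<lambda>\<tau>. f \<tau> \<tau> * x \<tau>) absolutely_integrable_on {0..T}"
    and "(\<lambda>s. integral {0..s} (\<lambda>\<tau>. g s \<tau> * x \<tau>)) absolutely_integrable_on {0..T}"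
    and "integral {0..T} (\<lambda>\<tau>. f T \<tau> * x \<tau>) = integral {0..T} (\<lambda>\<tau>. f \<tau> \<tau> * x \<tau>) +
           integral {0..T} (\<lambda>s. integral {0..s} (\<lambda>\<tau>. g s \<tau> * x \<tau>))"
    and "\<And>s. s \<in> {0..T} \<Longrightarrow> (\<lambda>\<tau>. g s \<tau> * x \<tau>) absolutely_integrable_on {0..s}"
proof -
  \<comment> \<open>a bounded extension of \<open>x\<close>, since the hypotheses on the kernel range over the whole half-line\<close>
  define z where "z \<tau> = x (min \<tau> T)" for \<tau>
  have zx: "z \<tau> = x \<tau>" if "\<tau> \<le> T" for \<tau> using that by (simp add: z_def)
  have z: "continuous_on {0..} z"
    unfolding z_def by (rule continuous_on_compose2[OF x]) (use T in \<open>auto intro!: continuous_intros\<close>)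
  have "bounded (x ` {0..T})"
    using x by (intro compact_imp_bounded compact_continuous_image) auto
  then obtain K where K: "\<And>\<tau>. \<tau> \<in> {0..T} \<Longrightarrow> \<bar>x \<tau>\<bar> \<le> K"
    unfolding bounded_iff real_norm_def by blast
  have zK: "\<bar>z \<tau>\<bar> \<le> K" if "0 \<le> \<tau>" for \<tau> using K[of "min \<tau> T"] that T by (simp add: z_def)
  have 1: "((\<lambda>s. f s \<tau> * z \<tau>) has_vector_derivative g t \<tau> * z \<tau>) (at t within {\<tau>..})"
    if "0 \<le> \<tau>" "\<tau> \<le> t" for \<tau> t
    using der[OF that] by (rule has_vector_derivative_mult_left)
  have 2: "(\<lambda>\<tau>. f t \<tau> * z \<tau>) absolutely_integrable_on {0..t}" if "0 \<le> t" for t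
    using int[OF that] by (rule absolutely_integrable_mult_continuous)
      (rule continuous_on_subset[OF z], auto)
  have 3: "(\<lambda>\<tau>. h s \<tau> * K) absolutely_integrable_on {0..s}" if "0 \<le> s" for s
    using h[OF that] by (rule set_integrable_mult_left)
  have 4: "\<bar>g s \<tau> * z \<tau>\<bar> \<le> h s \<tau> * K" if "0 \<le> \<tau>" "\<tau> \<le> s" for s \<tau>
    using le[OF that] zK[OF that(1)] by (simp add: abs_mult mult_mono)
  have 5: "(\<lambda>s. integral {0..s} (\<lambda>\<tau>. h s \<tau> * K)) absolutely_integrable_on {0..T}"
    using set_integrable_mult_left[OF h2, of K] by simp
  have eq: "integral {0..s} (\<lambda>\<tau>. u \<tau> * z \<tau>) = integral {0..s} (\<lambda>\<tau>. u \<tau> * x \<tau>)" if "s \<in> {0..T}" for s u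
    using that by (intro Henstock_Kurzweil_Integration.integral_cong) (auto simp: zx)
  have aieq: "(\<lambda>\<tau>. u \<tau> * z \<tau>) absolutely_integrable_on {0..s} \<longleftrightarrow> (\<lambda>\<tau>. u \<tau> * x \<tau>) absolutely_integrable_on {0..s}"
    if "s \<in> {0..T}" for s u
    using that by (intro set_integrable_cong) (auto simp: zx)
  have eq2: "integral {0..T} (\<lambda>s. integral {0..s} (\<lambda>\<tau>. g s \<tau> * z \<tau>)) =
      integral {0..T} (\<lambda>s. integral {0..s} (\<lambda>\<tau>. g s \<tau> * x \<tau>))"
    by (intro Henstock_Kurzweil_Integration.integral_cong eq)
  note ex = kernel_integral_exchange[of "\<lambda>t \<tau>. f t \<tau> * z \<tau>" "\<lambda>t \<tau>. g t \<tau> * z \<tau>" "\<lambda>s \<tau>. h s \<tau> * K",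
      OF 1 2 3 4 5 T]
  show "(\<lambda>\<tau>. f \<tau> \<tau> * x \<tau>) absolutely_integrable_on {0..T}"
    using ex(1) T by (simp add: aieq)
  show "(\<lambda>s. integral {0..s} (\<lambda>\<tau>. g s \<tau> * x \<tau>)) absolutely_integrable_on {0..T}"
    by (rule set_integrable_cong[THEN iffD1, OF refl refl _ ex(2)]) (auto simp: eq)
  show "integral {0..T} (\<lambda>\<tau>. f T \<tau> * x \<tau>) = integral {0..T} (\<lambda>\<tau>. f \<tau> \<tau> * x \<tau>) +
      integral {0..T} (\<lambda>s. integral {0..s} (\<lambda>\<tau>. g s \<tau> * x \<tau>))"
    using ex(3) T eq2 by (simp add: eq)
  show "(\<lambda>\<tau>. g s \<tau> * x \<tau>) absolutely_integrable_on {0..s}" if "s \<in> {0..T}" for s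
    using ex(4)[of s] that aieq[OF that] by simp
qed

text \<open>The homogeneous Gronwall inequality for an integrable, possibly unbounded coefficient.
  Uniform continuity of the primitive of \<open>a\<close> cuts \<open>{0..c}\<close> into finitely
  many short pieces, which are treated one by one from \<open>c\<close> downwards.\<close>

lemma gronwall_backward_zero:
  fixes a y :: "real \<Rightarrow> real"
  assumes a: "a absolutely_integrable_on {0..c}" "\<And>s. s \<in> {0..c} \<Longrightarrow> 0 \<le> a s"
    and y: "continuous_on {0..c} y" "\<And>s. s \<in> {0..c} \<Longrightarrow> 0 \<le> y s"
    and le: "\<And>s. s \<in> {0..c} \<Longrightarrow> y s \<le> integral {s..c} (\<lambda>\<tau>. a \<tau> * y \<tau>)"
    and s: "s \<in> {0..c}"
  shows "y s = 0"
proof -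
  have ai: "a integrable_on {u..v}" if "0 \<le> u" "v \<le> c" for u v
    using integrable_on_subinterval[OF set_lebesgue_integral_eq_integral(1)[OF a(1)]] that by auto
  have ayi: "(\<lambda>\<tau>. a \<tau> * y \<tau>) integrable_on {u..v}" if "0 \<le> u" "v \<le> c" for u v
    using integrable_on_subinterval[OF set_lebesgue_integral_eq_integral(1)
        [OF absolutely_integrable_mult_continuous[OF a(1) y(1)]]] that by auto
  have "uniformly_continuous_on {0..c} (\<lambda>x. integral {0..x} a)"
    by (intro compact_uniformly_continuous indefinite_integral_continuous_1 ai) auto
  then obtain d where d: "d > 0" "\<And>u v. u \<in> {0..c} \<Longrightarrow> v \<in> {0..c} \<Longrightarrow> \<bar>v - u\<bar> < d \<Longrightarrow>
      \<bar>integral {0..v} a - integral {0..u} a\<bar> < 1 / 2"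
    unfolding uniformly_continuous_on_def dist_real_def by (metis half_gt_zero zero_less_one)
  \<comment> \<open>\<open>y\<close> vanishes on \<open>[c - n e, c]\<close> for every \<open>n\<close>, because \<open>a\<close> has mass at most 1/2 on intervals of length \<open>e\<close>\<close>
  define e where "e = d / 2"
  have e: "e > 0" "e < d" using d(1) by (auto simp: e_def)
  have "\<forall>s\<in>{0..c}. c - s \<le> real n * e \<longrightarrow> y s = 0" for n
  proof (induction n)
    case 0
    show ?case
    proof (intro ballI impI)
      fix s assume "s \<in> {0..c}" "c - s \<le> real 0 * e"
      then have "s = c" by auto
      then show "y s = 0" using le[OF \<open>s \<in> {0..c}\<close>] y(2)[OF \<open>s \<in> {0..c}\<close>] by simp
    qed
  next
    case (Suc n)
    show ?case
    proof (intro ballI impI)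
      fix s assume s: "s \<in> {0..c}" and cs: "c - s \<le> real (Suc n) * e"
      define v where "v = min c (s + e)"
      have v: "s \<le> v" "v \<le> c" "v \<le> s + e" "c - v \<le> real n * e"
        using s e cs by (auto simp: v_def min_def algebra_simps)
      have "continuous_on {s..v} y" using y(1) by (rule continuous_on_subset) (use s v in auto)
      \<comment> \<open>At a maximum point \<open>u\<close> the hypothesis reads
        \<open>y u \<le> y u / 2\<close>: beyond \<open>v\<close> the integrand vanishes by
        induction, and on \<open>{u..v}\<close> the coefficient has mass at most 1/2.\<close>
      then obtain u where u: "u \<in> {s..v}" and um: "\<And>\<tau>. \<tau> \<in> {s..v} \<Longrightarrow> y \<tau> \<le> y u"
        using continuous_attains_sup[of "{s..v}" y] v(1) by auto
      have u0: "u \<in> {0..c}" using u s v by auto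
      have "integral {u..v} a = integral {0..v} a - integral {0..u} a"
        using Henstock_Kurzweil_Integration.integral_combine[of 0 u v a] ai[of 0 v] u u0 v by auto
      moreover have "\<bar>integral {0..v} a - integral {0..u} a\<bar> < 1 / 2"
        using u u0 v s e by (intro d(2)) auto
      ultimately have half: "integral {u..v} a \<le> 1 / 2" by linarith
      have "integral {v..c} (\<lambda>\<tau>. a \<tau> * y \<tau>) = integral {v..c} (\<lambda>\<tau>. 0)"
        using Suc.IH v s by (intro Henstock_Kurzweil_Integration.integral_cong) auto
      then have "integral {u..c} (\<lambda>\<tau>. a \<tau> * y \<tau>) = integral {u..v} (\<lambda>\<tau>. a \<tau> * y \<tau>)"
        using Henstock_Kurzweil_Integration.integral_combine[of u v c "\<lambda>\<tau>. a \<tau> * y \<tau>"] ayi[of u c] u u0 v by auto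
      also have "\<dots> \<le> integral {u..v} (\<lambda>\<tau>. a \<tau> * y u)"
        using u u0 v a(2) um
        by (intro integral_le ayi integrable_on_mult_left ai) (auto intro!: mult_left_mono)
      also have "\<dots> = integral {u..v} a * y u" by simp
      also have "\<dots> \<le> 1 / 2 * y u" using half y(2)[OF u0] by (intro mult_right_mono)
      finally have "y u \<le> 0" using le[OF u0] by simp
      then show "y s = 0" using um[of s] v y(2)[OF s] by auto
    qed
  qed
  moreover obtain n where "(c - s) / e \<le> real n" using real_arch_simple by blast
  then have "c - s \<le> real n * e" using e by (simp add: divide_le_eq)
  ultimately show ?thesis using s by blast
qed


section \<open>Pointwise hypothesis and integrated differential equation\<close>

text \<open>Let the left endpoint tend to \<open>t\<close>: the averages converge to
  \<open>psi_star\<close> at almost every \<open>t\<close> while the logarithmic norm stays fixed.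
  The strict inequality becomes a weak one.\<close>

lemma log_norm_condition_imp_AE:
  fixes b :: "'n::finite \<Rightarrow> 'n \<Rightarrow> real \<Rightarrow> real \<Rightarrow> real"
  assumes cond: "log_norm_condition b F \<epsilon>"
    and int: "\<And>T. 0 \<le> T \<Longrightarrow> psi_star b F \<epsilon> absolutely_integrable_on {0..T}"
  shows "\<exists>N. negligible N \<and> (\<forall>t. 0 < t \<longrightarrow> t \<notin> N \<longrightarrow> log_norm (B_mat b t) + psi_star b F \<epsilon> t \<le> 0)"
proof -
  \<comment> \<open>Extension by zero, since the differentiation lemma asks for integrability on
    every interval of the line.\<close>
  define p where "p t = (if t \<in> {0..} then psi_star b F \<epsilon> t else 0)" for t
  have "p integrable_on {u..v}" for u v
  proof -
    have "{0..} \<inter> {u..v} = {max 0 u..v}" by auto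
    moreover have "psi_star b F \<epsilon> integrable_on {max 0 u..v}"
      using set_lebesgue_integral_eq_integral(1)[OF int[of "max 0 v"]]
      by (rule integrable_on_subinterval) auto
    ultimately have "psi_star b F \<epsilon> integrable_on {0..} \<inter> {u..v}" by simp
    then show ?thesis unfolding p_def by (simp only: integrable_restrict_Int)
  qed
  then obtain N where N: "negligible N"
    "\<And>t. t \<notin> N \<Longrightarrow> ((\<lambda>s. integral {s..t} p / (t - s)) \<longlongrightarrow> p t) (at_left t)"
    using lebesgue_differentiation_left by metis
  have "log_norm (B_mat b t) + psi_star b F \<epsilon> t \<le> 0" if "0 < t" "t \<notin> N" for t
  proof -
    have "((\<lambda>s. log_norm (B_mat b t) + integral {s..t} p / (t - s)) \<longlongrightarrow> log_norm (B_mat b t) + p t) (at_left t)"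
      using N(2)[OF that(2)] by (intro tendsto_intros)
    moreover have "\<forall>\<^sub>F s in at_left t. 0 < s \<and> s < t"
      unfolding eventually_at_left[OF that(1)] using that(1) by blast
    then have "\<forall>\<^sub>F s in at_left t. log_norm (B_mat b t) + integral {s..t} p / (t - s) \<le> 0"
    proof eventually_elim
      case (elim s)
      then have "integral {s..t} p = integral {s..t} (psi_star b F \<epsilon>)"
        by (intro Henstock_Kurzweil_Integration.integral_cong) (auto simp: p_def)
      moreover have "log_norm (B_mat b t) + 1 / (t - s) * integral {s..t} (psi_star b F \<epsilon>) < 0"
        using cond elim unfolding log_norm_condition_def by auto
      ultimately show ?case by simp
    qed
    ultimately have "log_norm (B_mat b t) + p t \<le> 0"
      by (rule tendsto_upperbound) simp
    then show ?thesis using that by (simp add: p_def)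
  qed
  with N(1) show ?thesis by blast
qed

lemma has_integral_deriv_on_halfline:
  fixes F :: "real \<Rightarrow> real ^ 'n"
  assumes F: "perturbation F" and T: "0 \<le> T"
  shows "((\<lambda>s. deriv_on_halfline F s $ k) has_integral F T $ k) {0..T}"
proof -
  have "((\<lambda>s. F s $ k) has_vector_derivative deriv_on_halfline F s $ k) (at s within {0..T})"
    if "s \<in> {0..T}" for s
  proof -
    have "(F has_vector_derivative deriv_on_halfline F s) (at s within {0..})"
      using F that unfolding perturbation_def deriv_on_halfline_def vector_derivative_works[symmetric] by auto
    then have "(F has_vector_derivative deriv_on_halfline F s) (at s within {0..T})"
      by (rule has_vector_derivative_within_subset) auto
    then show ?thesis
      by (rule bounded_linear.has_vector_derivative[OF bounded_linear_vec_nth])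
  qed
  from fundamental_theorem_of_calculus[OF T this]
  show ?thesis using F by (simp add: perturbation_def)
qed

lemma psi_star_absolutely_integrable:
  fixes b :: "'n::finite \<Rightarrow> 'n \<Rightarrow> real \<Rightarrow> real \<Rightarrow> real"
  assumes "volterra_kernel b" "perturbation F" "0 \<le> T"
  shows "psi_star b F \<epsilon> absolutely_integrable_on {0..T}"
proof -
  have "continuous_on {0..T} (\<lambda>s. infnorm (deriv_on_halfline F s) / \<epsilon>)"
    unfolding divide_inverse using assms(2)
    by (intro continuous_intros) (auto simp: perturbation_def elim: continuous_on_subset)
  then have "(\<lambda>s. infnorm (deriv_on_halfline F s) / \<epsilon>) absolutely_integrable_on {0..T}"
    by (rule absolutely_integrable_continuous_real)
  then show ?thesis
    using assms(1,3) unfolding volterra_kernel_def psi_star_def[abs_def]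
    by (intro set_integral_add(1)) auto
qed

text \<open>The differentiated system is kept in integrated form, so \<open>X\<close> itself is
  never differentiated. The other two conclusions serve the Gronwall coefficient and the estimate of
  the memory term.\<close>

lemma solution_as_integral:
  fixes b :: "'n::finite \<Rightarrow> 'n \<Rightarrow> real \<Rightarrow> real \<Rightarrow> real"
  assumes b: "volterra_kernel b" and F: "perturbation F" and X: "solves_perturbed b F X"
    and T: "0 \<le> T"
  shows "((\<lambda>s. (B_mat b s *v X s) $ k
      + integral {0..s} (\<lambda>\<tau>. (C_mat b s \<tau> *v X \<tau>) $ k) + deriv_on_halfline F s $ k)
      has_integral X T $ k) {0..T}"
    and "(\<lambda>s. b k k s s) absolutely_integrable_on {0..T}"
    and "\<And>s. s \<in> {0..T} \<Longrightarrow> (\<lambda>\<tau>. (C_mat b s \<tau> *v X \<tau>) $ k) absolutely_integrable_on {0..s}"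
proof -
  have der: "((\<lambda>s. b k l s \<tau>) has_vector_derivative C_mat b t \<tau> $ k $ l) (at t within {\<tau>..})"
    if "0 \<le> \<tau>" "\<tau> \<le> t" for l \<tau> t
    using b that unfolding volterra_kernel_def C_mat_def by (simp add: vector_derivative_works)
  have int: "b k l t absolutely_integrable_on {0..t}" if "0 \<le> t" for l t
    using b that unfolding volterra_kernel_def by simp
  have h: "(\<lambda>\<tau>. inf_opnorm (C_mat b s \<tau>)) absolutely_integrable_on {0..s}" if "0 \<le> s" for s
    using b that unfolding volterra_kernel_def by simp
  have h2: "(\<lambda>s. integral {0..s} (\<lambda>\<tau>. inf_opnorm (C_mat b s \<tau>))) absolutely_integrable_on {0..T}"
    using b T unfolding volterra_kernel_def by simp
  have Xc: "continuous_on {0..T} (\<lambda>\<tau>. X \<tau> $ l)" for l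
    using X unfolding solves_perturbed_def
    by (intro continuous_intros) (auto elim: continuous_on_subset)
  \<comment> \<open>The weight stays arbitrary because it is taken both as a component of
    \<open>X\<close> and as the constant 1, the latter for integrability of the bare
    diagonal.\<close>
  have ex: "(\<lambda>\<tau>. b k l \<tau> \<tau> * x \<tau>) absolutely_integrable_on {0..T}"
      "(\<lambda>s. integral {0..s} (\<lambda>\<tau>. C_mat b s \<tau> $ k $ l * x \<tau>)) absolutely_integrable_on {0..T}"
      "integral {0..T} (\<lambda>\<tau>. b k l T \<tau> * x \<tau>) = integral {0..T} (\<lambda>\<tau>. b k l \<tau> \<tau> * x \<tau>) +
         integral {0..T} (\<lambda>s. integral {0..s} (\<lambda>\<tau>. C_mat b s \<tau> $ k $ l * x \<tau>))"
      "\<And>s. s \<in> {0..T} \<Longrightarrow> (\<lambda>\<tau>. C_mat b s \<tau> $ k $ l * x \<tau>) absolutely_integrable_on {0..s}"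
    if "continuous_on {0..T} x" for l x
    by (rule kernel_integral_exchange_mult[of "b k l" "\<lambda>t \<tau>. C_mat b t \<tau> $ k $ l"
            "\<lambda>s \<tau>. inf_opnorm (C_mat b s \<tau>)", OF der int h abs_entry_le_inf_opnorm h2 T];
        (assumption | rule that))+
  have hi: "f absolutely_integrable_on S \<Longrightarrow> (f has_integral integral S f) S" for f :: "real \<Rightarrow> real" and S
    using integrable_integral set_lebesgue_integral_eq_integral(1) by blast
  have C: "(\<lambda>\<tau>. C_mat b s \<tau> $ k $ l * X \<tau> $ l) absolutely_integrable_on {0..s}" if "s \<in> {0..T}" for s l
    using Xc that by (rule ex(4))
  show "(\<lambda>\<tau>. (C_mat b s \<tau> *v X \<tau>) $ k) absolutely_integrable_on {0..s}" if "s \<in> {0..T}" for s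
    unfolding matrix_vector_mult_def using C[OF that] by (simp add: absolutely_integrable_sum)
  have Csum: "integral {0..s} (\<lambda>\<tau>. (C_mat b s \<tau> *v X \<tau>) $ k)
      = (\<Sum>l\<in>UNIV. integral {0..s} (\<lambda>\<tau>. C_mat b s \<tau> $ k $ l * X \<tau> $ l))" if "s \<in> {0..T}" for s
    unfolding matrix_vector_mult_def using C[OF that]
    by (simp add: Henstock_Kurzweil_Integration.integral_sum set_lebesgue_integral_eq_integral(1))
  show "(\<lambda>s. b k k s s) absolutely_integrable_on {0..T}"
    using ex(1)[of "\<lambda>_. 1" k] by simp
  have "((\<lambda>s. \<Sum>l\<in>UNIV. b k l s s * X s $ l + integral {0..s} (\<lambda>\<tau>. C_mat b s \<tau> $ k $ l * X \<tau> $ l))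
     has_integral (\<Sum>l\<in>UNIV. integral {0..T} (\<lambda>\<tau>. b k l T \<tau> * X \<tau> $ l))) {0..T}"
    unfolding ex(3)[OF Xc]
    by (intro has_integral_sum has_integral_add hi ex(1) ex(2) Xc) auto
  then have "((\<lambda>s. (\<Sum>l\<in>UNIV. b k l s s * X s $ l + integral {0..s} (\<lambda>\<tau>. C_mat b s \<tau> $ k $ l * X \<tau> $ l))
      + deriv_on_halfline F s $ k) has_integral
      (\<Sum>l\<in>UNIV. integral {0..T} (\<lambda>\<tau>. b k l T \<tau> * X \<tau> $ l)) + F T $ k) {0..T}"
    by (intro has_integral_add has_integral_deriv_on_halfline F T)
  also have "(\<Sum>l\<in>UNIV. integral {0..T} (\<lambda>\<tau>. b k l T \<tau> * X \<tau> $ l)) + F T $ k = X T $ k"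
    using X T unfolding solves_perturbed_def by simp
  finally show "((\<lambda>s. (B_mat b s *v X s) $ k
      + integral {0..s} (\<lambda>\<tau>. (C_mat b s \<tau> *v X \<tau>) $ k) + deriv_on_halfline F s $ k)
      has_integral X T $ k) {0..T}"
    by (rule has_integral_eq[rotated])
       (simp add: Csum sum.distrib, simp add: matrix_vector_mult_def B_mat_def)
qed


section \<open>The a priori bound for solutions\<close>

lemma infnorm_attained: "\<exists>k. \<bar>x $ k\<bar> = infnorm (x :: real ^ 'n)"
proof -
  have "Max (range (\<lambda>k. \<bar>x $ k\<bar>)) \<in> range (\<lambda>k. \<bar>x $ k\<bar>)" by (rule Max_in) auto
  then obtain k where "\<bar>x $ k\<bar> = Max (range (\<lambda>k. \<bar>x $ k\<bar>))" by force
  then have "infnorm x \<le> \<bar>x $ k\<bar>" by (simp add: infnorm_le_iff_cart)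
  then show ?thesis using component_le_infnorm_cart[of x k] by (intro exI[of _ k]) linarith
qed

text \<open>If \<open>x\<^sub>k\<close> has the largest modulus \<open>M\<close>, say with sign \<open>\<sigma>\<close>, then
  \<open>\<sigma> (B x)\<^sub>k \<le> b\<^sub>k\<^sub>k \<sigma> x\<^sub>k + M \<Sum>\<^sub>j\<^sub>\<noteq>\<^sub>k \<bar>b\<^sub>k\<^sub>j\<bar>\<close>, and the diagonal term is rewritten with the defect \<open>M - \<sigma> x\<^sub>k\<close>.\<close>

lemma matrix_vector_mult_le_log_norm:
  fixes A :: "real ^ 'n ^ 'n"
  assumes x: "infnorm x \<le> M" and \<sigma>: "\<bar>\<sigma>\<bar> = 1"
  shows "\<sigma> * (A *v x) $ k \<le> M * log_norm A + \<bar>A $ k $ k\<bar> * (M - \<sigma> * x $ k)"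
proof -
  have xM: "\<bar>x $ j\<bar> \<le> M" for j using x infnorm_le_iff_cart by blast
  have M: "0 \<le> M" using infnorm_pos_le[of x] x by linarith
  have "\<sigma> * x $ k \<le> M" using xM[of k] \<sigma> by (auto simp: abs_if split: if_splits)
  \<comment> \<open>This puts the modulus of the diagonal entry in front of the defect, as
    Gronwall's inequality asks for a nonnegative coefficient.\<close>
  then have "0 \<le> (\<bar>A $ k $ k\<bar> + A $ k $ k) * (M - \<sigma> * x $ k)"
    by (intro mult_nonneg_nonneg) auto
  then have diag: "A $ k $ k * (\<sigma> * x $ k) \<le> M * A $ k $ k + \<bar>A $ k $ k\<bar> * (M - \<sigma> * x $ k)"
    by (simp add: algebra_simps)
  have "\<sigma> * (A *v x) $ k = A $ k $ k * (\<sigma> * x $ k) + (\<Sum>j\<in>UNIV - {k}. \<sigma> * (A $ k $ j * x $ j))"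
    unfolding matrix_vector_mult_def
    by (simp add: sum.remove[of UNIV k] distrib_left sum_distrib_left mult.left_commute)
  also have "(\<Sum>j\<in>UNIV - {k}. \<sigma> * (A $ k $ j * x $ j)) \<le> (\<Sum>j\<in>UNIV - {k}. M * \<bar>A $ k $ j\<bar>)"
  proof (rule sum_mono)
    fix j
    have "\<sigma> * (A $ k $ j * x $ j) \<le> \<bar>\<sigma> * (A $ k $ j * x $ j)\<bar>" by (rule abs_ge_self)
    also have "\<dots> = \<bar>x $ j\<bar> * \<bar>A $ k $ j\<bar>" using \<sigma> by (simp add: abs_mult)
    also have "\<dots> \<le> M * \<bar>A $ k $ j\<bar>" by (intro mult_right_mono xM) simp
    finally show "\<sigma> * (A $ k $ j * x $ j) \<le> M * \<bar>A $ k $ j\<bar>" .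
  qed
  also have "A $ k $ k * (\<sigma> * x $ k) + (\<Sum>j\<in>UNIV - {k}. M * \<bar>A $ k $ j\<bar>) \<le>
      M * (A $ k $ k + (\<Sum>j\<in>UNIV - {k}. \<bar>A $ k $ j\<bar>)) + \<bar>A $ k $ k\<bar> * (M - \<sigma> * x $ k)"
    using diag by (simp add: distrib_left sum_distrib_left)
  also have "\<dots> \<le> M * log_norm A + \<bar>A $ k $ k\<bar> * (M - \<sigma> * x $ k)"
    using row_le_log_norm[of A k] M by (intro add_right_mono mult_left_mono)
  finally show ?thesis by simp
qed

lemma solution_bounded:
  fixes b :: "'n::finite \<Rightarrow> 'n \<Rightarrow> real \<Rightarrow> real \<Rightarrow> real"
  assumes b: "volterra_kernel b" and \<epsilon>: "0 < \<epsilon>" and F: "perturbation F"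
    and cond: "log_norm_condition b F \<epsilon>" and X: "solves_perturbed b F X" and T: "0 \<le> T"
  shows "infnorm (X T) \<le> \<epsilon>"
proof (rule ccontr)
  assume "\<not> infnorm (X T) \<le> \<epsilon>"
  have Xc: "continuous_on {0..T} X"
    using X unfolding solves_perturbed_def by (auto elim: continuous_on_subset)
  have "\<exists>c\<in>{0..T}. \<forall>s\<in>{0..T}. infnorm (X s) \<le> infnorm (X c)"
    using T by (intro continuous_attains_sup continuous_on_infnorm Xc) auto
  then obtain c where c: "c \<in> {0..T}" "\<And>s. s \<in> {0..T} \<Longrightarrow> infnorm (X s) \<le> infnorm (X c)"
    by blast
  define M where "M = infnorm (X c)"
  have M: "\<epsilon> < M" using c(2)[of T] T \<open>\<not> infnorm (X T) \<le> \<epsilon>\<close> by (simp add: M_def)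
  have XM: "infnorm (X s) \<le> M" if "s \<in> {0..c}" for s
    using c that by (auto simp: M_def)
  obtain k where k: "\<bar>X c $ k\<bar> = M" using infnorm_attained[of "X c"] unfolding M_def by blast
  define \<sigma> :: real where "\<sigma> = (if X c $ k < 0 then -1 else 1)"
  have \<sigma>: "\<bar>\<sigma>\<bar> = 1" "\<sigma> * X c $ k = M"
    using k M \<epsilon> by (auto simp: \<sigma>_def)
  define y where "y s = M - \<sigma> * X s $ k" for s
  have y0: "0 \<le> y s" if "s \<in> {0..c}" for s
  proof -
    have "\<bar>\<sigma> * X s $ k\<bar> = \<bar>X s $ k\<bar>"
      unfolding abs_mult \<sigma>(1) by (rule mult_1)
    then show ?thesis
      unfolding y_def using XM[OF that] component_le_infnorm_cart[of "X s" k] by linarith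
  qed
  have yc: "continuous_on {0..c} y"
    unfolding y_def[abs_def] using c
    by (intro continuous_on_diff continuous_on_const continuous_on_mult continuous_on_component
        continuous_on_subset[OF Xc]) auto
  have c0: "0 \<le> c" using c by simp
  define \<Phi> where "\<Phi> s = (B_mat b s *v X s) $ k
      + integral {0..s} (\<lambda>\<tau>. (C_mat b s \<tau> *v X \<tau>) $ k) + deriv_on_halfline F s $ k" for s
  have \<Phi>: "(\<Phi> has_integral X s $ k) {0..s}" if "0 \<le> s" for s
    unfolding \<Phi>_def[abs_def] using solution_as_integral(1)[OF b F X that] .
  have diag: "(\<lambda>s. \<bar>b k k s s\<bar>) absolutely_integrable_on {0..c}"
    using solution_as_integral(2)[OF b F X c0] by (rule set_integrable_abs)
  obtain N where N: "negligible N"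
    "\<And>t. 0 < t \<Longrightarrow> t \<notin> N \<Longrightarrow> log_norm (B_mat b t) + psi_star b F \<epsilon> t \<le> 0"
    using log_norm_condition_imp_AE[OF cond psi_star_absolutely_integrable[OF b F]] by metis
  have \<Phi>_le: "\<sigma> * \<Phi> s \<le> \<bar>b k k s s\<bar> * y s" if s: "s \<in> {0..c}" "0 < s" "s \<notin> N" for s
  proof -
    have 1: "\<sigma> * (B_mat b s *v X s) $ k \<le> M * log_norm (B_mat b s) + \<bar>b k k s s\<bar> * y s"
      using matrix_vector_mult_le_log_norm[OF XM[OF s(1)] \<sigma>(1), of "B_mat b s" k]
      by (simp add: B_mat_def y_def)
    have h: "(\<lambda>\<tau>. inf_opnorm (C_mat b s \<tau>)) absolutely_integrable_on {0..s}"
      using b s unfolding volterra_kernel_def by simp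
    have "norm (integral {0..s} (\<lambda>\<tau>. (C_mat b s \<tau> *v X \<tau>) $ k))
        \<le> integral {0..s} (\<lambda>\<tau>. M * inf_opnorm (C_mat b s \<tau>))"
    proof (rule integral_norm_bound_integral)
      show "(\<lambda>\<tau>. (C_mat b s \<tau> *v X \<tau>) $ k) integrable_on {0..s}"
        using solution_as_integral(3)[OF b F X c0 s(1)] by (rule set_lebesgue_integral_eq_integral(1))
      show "(\<lambda>\<tau>. M * inf_opnorm (C_mat b s \<tau>)) integrable_on {0..s}"
        by (intro integrable_on_mult_right set_lebesgue_integral_eq_integral(1) h)
      fix \<tau> assume \<tau>: "\<tau> \<in> {0..s}"
      have "norm ((C_mat b s \<tau> *v X \<tau>) $ k) \<le> infnorm (C_mat b s \<tau> *v X \<tau>)"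
        by (simp add: component_le_infnorm_cart)
      also have "\<dots> \<le> inf_opnorm (C_mat b s \<tau>) * infnorm (X \<tau>)"
        by (rule infnorm_mult_le_inf_opnorm)
      also have "\<dots> \<le> inf_opnorm (C_mat b s \<tau>) * M"
        using XM[of \<tau>] \<tau> s abs_entry_le_inf_opnorm[of "C_mat b s \<tau>" k k]
        by (intro mult_left_mono) auto
      finally show "norm ((C_mat b s \<tau> *v X \<tau>) $ k) \<le> M * inf_opnorm (C_mat b s \<tau>)"
        by (simp add: mult.commute)
    qed
    also have "\<dots> = M * integral {0..s} (\<lambda>\<tau>. inf_opnorm (C_mat b s \<tau>))" by simp
    finally have I: "\<bar>integral {0..s} (\<lambda>\<tau>. (C_mat b s \<tau> *v X \<tau>) $ k)\<bar> \<le> \<dots>" by simp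
    have "\<bar>\<sigma> * u\<bar> = \<bar>u\<bar>" for u unfolding abs_mult \<sigma>(1) by (rule mult_1)
    then have \<sigma>_le: "\<sigma> * u \<le> \<bar>u\<bar>" for u using abs_ge_self[of "\<sigma> * u"] by simp
    note 2 = order_trans[OF \<sigma>_le I]
    have "\<sigma> * deriv_on_halfline F s $ k \<le> infnorm (deriv_on_halfline F s) * 1"
      using order_trans[OF \<sigma>_le component_le_infnorm_cart] by simp
    \<comment> \<open>Here \<open>\<epsilon> < M\<close> enters: the forcing term is enlarged by
      \<open>M / \<epsilon>\<close>, so that \<open>M\<close> can be factored out of all terms and
      \<open>psi_star\<close> appears.\<close>
    also have "infnorm (deriv_on_halfline F s) * 1 \<le> infnorm (deriv_on_halfline F s) * (M / \<epsilon>)"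
      using M \<epsilon> by (intro mult_left_mono infnorm_pos_le) (simp add: pos_le_divide_eq)
    finally have 3: "\<sigma> * deriv_on_halfline F s $ k \<le> infnorm (deriv_on_halfline F s) * (M / \<epsilon>)"
      by (simp only: mult_1_right)
    have "\<sigma> * \<Phi> s = \<sigma> * (B_mat b s *v X s) $ k
        + \<sigma> * integral {0..s} (\<lambda>\<tau>. (C_mat b s \<tau> *v X \<tau>) $ k) + \<sigma> * deriv_on_halfline F s $ k"
      by (simp only: \<Phi>_def distrib_left)
    moreover have "M * (log_norm (B_mat b s) + psi_star b F \<epsilon> s) = M * log_norm (B_mat b s)
        + M * integral {0..s} (\<lambda>\<tau>. inf_opnorm (C_mat b s \<tau>)) + infnorm (deriv_on_halfline F s) * (M / \<epsilon>)"
      by (simp add: psi_star_def distrib_left)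
    moreover have "M * (log_norm (B_mat b s) + psi_star b F \<epsilon> s) \<le> 0"
      using N(2)[OF s(2,3)] M \<epsilon> by (intro mult_nonneg_nonpos) auto
    ultimately show ?thesis using 1 2 3 by linarith
  qed
  have y_le: "y s \<le> integral {s..c} (\<lambda>\<tau>. \<bar>b k k \<tau> \<tau>\<bar> * y \<tau>)" if s: "s \<in> {0..c}" for s
  proof -
    have int: "\<Phi> integrable_on {s..c}"
      using has_integral_integrable[OF \<Phi>[OF c0]] by (rule integrable_on_subinterval) (use s in auto)
    have "X c $ k = X s $ k + integral {s..c} \<Phi>"
      using Henstock_Kurzweil_Integration.integral_combine[of 0 s c \<Phi>]
        has_integral_integrable[OF \<Phi>[OF c0]] integral_unique[OF \<Phi>[OF c0]]
        integral_unique[OF \<Phi>[of s]] s by simp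
    then have "y s = \<sigma> * integral {s..c} \<Phi>"
      using \<sigma>(2) by (simp add: y_def algebra_simps)
    also have "\<dots> = integral {s..c} (\<lambda>\<tau>. \<sigma> * \<Phi> \<tau>)" by simp
    also have "\<dots> \<le> integral {s..c} (\<lambda>\<tau>. \<bar>b k k \<tau> \<tau>\<bar> * y \<tau>)"
    proof -
      \<comment> \<open>The integrand is changed on a null set to make the comparison hold at every
        point; 0 is included because \<open>\<Phi>_le\<close> covers positive arguments
        only.\<close>
      define v where "v \<tau> = (if \<tau> \<in> insert 0 N then \<bar>b k k \<tau> \<tau>\<bar> * y \<tau> else \<sigma> * \<Phi> \<tau>)" for \<tau>
      have neg: "negligible (insert 0 N)" using N(1) by simp
      have "integral {s..c} (\<lambda>\<tau>. \<sigma> * \<Phi> \<tau>) = integral {s..c} v"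
        by (rule integral_spike[OF neg]) (simp add: v_def)
      also have "\<dots> \<le> integral {s..c} (\<lambda>\<tau>. \<bar>b k k \<tau> \<tau>\<bar> * y \<tau>)"
      proof (rule integral_le)
        show "v integrable_on {s..c}"
          using integrable_on_mult_right[OF int, of \<sigma>] by (rule integrable_spike[OF _ neg]) (simp add: v_def)
        show "(\<lambda>\<tau>. \<bar>b k k \<tau> \<tau>\<bar> * y \<tau>) integrable_on {s..c}"
          using set_lebesgue_integral_eq_integral(1)[OF absolutely_integrable_mult_continuous[OF diag yc]]
          by (rule integrable_on_subinterval) (use s in auto)
        show "v \<tau> \<le> \<bar>b k k \<tau> \<tau>\<bar> * y \<tau>" if "\<tau> \<in> {s..c}" for \<tau>
          using \<Phi>_le[of \<tau>] that s by (auto simp: v_def)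
      qed
      finally show ?thesis .
    qed
    finally show ?thesis .
  qed
  have "y 0 = 0"
    by (rule gronwall_backward_zero[OF diag _ yc y0 y_le]) (use c0 in auto)
  \<comment> \<open>The integral representation on the degenerate interval gives
    \<open>X 0 $ k = 0\<close>, hence \<open>y 0 = M > 0\<close>.\<close>
  moreover have "X 0 $ k = 0" using integral_unique[OF \<Phi>[of 0]] by simp
  ultimately show False using M \<epsilon> by (simp add: y_def)
qed

section \<open>Scaling of perturbations and stability\<close>

lemma deriv_on_halfline_scaleR:
  assumes "F differentiable (at t within {0..})" "0 \<le> t"
  shows "deriv_on_halfline (\<lambda>t. r *\<^sub>R F t) t = r *\<^sub>R deriv_on_halfline F t"
  unfolding deriv_on_halfline_def
proof (rule vector_derivative_within)
  have "(F has_vector_derivative vector_derivative F (at t within {0..})) (at t within {0..})"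
    using assms(1) vector_derivative_works by blast
  then show "((\<lambda>t. r *\<^sub>R F t) has_vector_derivative r *\<^sub>R vector_derivative F (at t within {0..}))
      (at t within {0..})"
    by (rule bounded_linear.has_vector_derivative[OF bounded_linear_scaleR_right])
  have "t islimpt {0..}"
    by (rule islimpt_subset[of t "{t..t + 1}"]) (use assms(2) in auto)
  then show "at t within {0..} \<noteq> bot" by (simp add: trivial_limit_within)
qed

lemma perturbation_scaleR:
  assumes "perturbation F"
  shows "perturbation (\<lambda>t. r *\<^sub>R F t)"
proof -
  have d: "F differentiable (at t within {0..})" if "0 \<le> t" for t
    using assms that by (simp add: perturbation_def)
  have "continuous_on {0..} (\<lambda>t. r *\<^sub>R deriv_on_halfline F t)"
    using assms by (auto simp: perturbation_def intro: continuous_intros)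
  then have "continuous_on {0..} (deriv_on_halfline (\<lambda>t. r *\<^sub>R F t))"
    using d by (subst continuous_on_cong[OF refl deriv_on_halfline_scaleR]) auto
  moreover have "(\<lambda>t. r *\<^sub>R F t) differentiable (at t within {0..})" if "0 \<le> t" for t
    using d[OF that] by (intro derivative_intros)
  ultimately show ?thesis using assms by (simp add: perturbation_def)
qed

lemma solves_perturbed_scaleR:
  assumes "solves_perturbed b F X"
  shows "solves_perturbed b (\<lambda>t. r *\<^sub>R F t) (\<lambda>t. r *\<^sub>R X t)"
  using assms unfolding solves_perturbed_def
  by (auto simp: distrib_left sum_distrib_left mult.left_commute[of _ r] intro!: continuous_intros)


text \<open>The condition depends on the perturbation. Stability concerns all small perturbations,
  so it is derived from the condition for every admissible \<open>F\<close>; the bound on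
  \<open>X\<close> uses it for the given \<open>F\<close> alone.\<close>

theorem theorem1:
  fixes b :: "'n::finite \<Rightarrow> 'n \<Rightarrow> real \<Rightarrow> real \<Rightarrow> real" and \<epsilon> \<epsilon>\<^sub>0 :: real
  assumes "volterra_kernel b" and "0 < \<epsilon>" and "0 < \<epsilon>\<^sub>0" and "\<epsilon>\<^sub>0 \<le> \<epsilon>"
  shows "((\<forall>F. perturbation F \<and> deriv_bounded_by \<epsilon>\<^sub>0 F \<longrightarrow> log_norm_condition b F \<epsilon>)
            \<longrightarrow> trivial_solution_stable b) \<and>
         (\<forall>F X. perturbation F \<and> deriv_bounded_by \<epsilon>\<^sub>0 F \<and> log_norm_condition b F \<epsilon> \<and>
            solves_perturbed b F X \<longrightarrow> (\<forall>t\<ge>0. infnorm (X t) \<le> \<epsilon>))"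
proof (intro conjI impI allI)
  fix F X and t :: real
  assume "perturbation F \<and> deriv_bounded_by \<epsilon>\<^sub>0 F \<and> log_norm_condition b F \<epsilon> \<and> solves_perturbed b F X"
    and "0 \<le> t"
  then show "infnorm (X t) \<le> \<epsilon>" using solution_bounded assms by blast
next
  assume cond: "\<forall>F. perturbation F \<and> deriv_bounded_by \<epsilon>\<^sub>0 F \<longrightarrow> log_norm_condition b F \<epsilon>"
  show "trivial_solution_stable b"
    unfolding trivial_solution_stable_def
  proof (intro allI impI)
    fix \<eta> :: real assume \<eta>: "0 < \<eta>"
    \<comment> \<open>Scaling by \<open>r\<close> turns the target bound \<open>\<eta>\<close> into
      \<open>\<epsilon>\<close>. The choice \<open>\<epsilon>\<^sub>0 / r\<close> for
      \<open>\<delta>\<close> makes the scaled perturbation admissible.\<close>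
    define r where "r = \<epsilon> / \<eta>"
    have r: "0 < r" using \<eta> assms by (simp add: r_def)
    have "infnorm (X t) \<le> \<eta>"
      if F: "perturbation F" "deriv_bounded_by (\<epsilon>\<^sub>0 / r) F" and X: "solves_perturbed b F X" and t: "0 \<le> t"
      for F X t
    proof -
      have rF: "perturbation (\<lambda>t. r *\<^sub>R F t)" using F(1) by (rule perturbation_scaleR)
      moreover have "deriv_bounded_by \<epsilon>\<^sub>0 (\<lambda>t. r *\<^sub>R F t)"
        using F r unfolding deriv_bounded_by_def perturbation_def
        by (auto simp: deriv_on_halfline_scaleR infnorm_mul pos_le_divide_eq mult.commute)
      ultimately have "infnorm (r *\<^sub>R X t) \<le> \<epsilon>"
        using solution_bounded[OF assms(1,2) rF _ solves_perturbed_scaleR[OF X] t] cond by blast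
      then show ?thesis using r \<eta> assms(2) by (simp add: infnorm_mul r_def field_simps)
    qed
    then show "\<exists>\<delta>>0. \<forall>F X. perturbation F \<longrightarrow> deriv_bounded_by \<delta> F \<longrightarrow> solves_perturbed b F X \<longrightarrow>
        (\<forall>t\<ge>0. infnorm (X t) \<le> \<eta>)"
      using r assms(3) by (intro exI[of _ "\<epsilon>\<^sub>0 / r"]) auto
  qed
qed


end
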